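(* Let $\mathcal{D}$ and $\mathcal{W}$ be nonempty subsets of (potentially different) Euclidean spaces and let $\mathsf{K}:\mathcal{D}\to\mathcal{P}(\mathcal{W})$ be a Markov kernel. For every $\gamma\ge 1$, $$\eta_\gamma(\mathsf{K})=\sup_{x_1,x_2\in\mathcal{D}}\mathsf{E}_\gamma\big(\mathsf{K}(\cdot|x_1)\,\|\,\mathsf{K}(\cdot|x_2)\big).$$ Furthermore, for every $0<\gamma<1$, $\eta_\gamma(\mathsf{K})=\eta_{1/\gamma}(\mathsf{K})$.
   Context: $\mathcal{P}(\cdot)$ denotes the set of probability measures on a set. For $\gamma\ge 0$ and probability measures $\mu,\nu$ on the same space, $\mathsf{E}_\gamma(\mu\|\nu)=\sup_{A}[\mu(A)-\gamma\nu(A)]-(1-\gamma)^+$, the supremum being over measurable sets $A$, with $(a)^+=\max(0,a)$. For $\mu\in\mathcal{P}(\mathcal{D})$, $\mu\mathsf{K}=\int\mu(dx)\,\mathsf{K}(\cdot|x)$ is the push-forward of $\mu$ under $\mathsf{K}$. The contraction coefficient is $\eta_\gamma(\mathsf{K})=\sup\left\{\frac{\mathsf{E}_\gamma(\mu\mathsf{K}\|\nu\mathsf{K})}{\mathsf{E}_\gamma(\mu\|\nu)}:\mu,\nu\in\mathcal{P}(\mathcal{D}),\ \mathsf{E}_\gamma(\mu\|\nu)\ne0\right\}$ (the supremum of the empty set being $0$). *)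

theory Defs
  imports "HOL-Probability.Probability"
begin

definition hockey_stick :: "real \<Rightarrow> 'a measure \<Rightarrow> 'a measure \<Rightarrow> real" where
  "hockey_stick \<gamma> \<mu> \<nu> =
     (SUP A\<in>sets \<mu>. measure \<mu> A - \<gamma> * measure \<nu> A) - max 0 (1 - \<gamma>)"

text \<open>For probability measures on a common space and \<open>\<gamma> \<ge> 0\<close> the real supremum above ranges over a
  bounded nonempty set and the divergence is nonnegative, so that the embedding into
  \<^typ>\<open>ennreal\<close> used below loses nothing.\<close>

lemma hockey_stick_bdd:
  assumes "prob_space \<mu>" "0 \<le> \<gamma>"
  shows "bdd_above ((\<lambda>A. measure \<mu> A - \<gamma> * measure \<nu> A) ` sets \<mu>)"
proof (rule bdd_aboveI2)
  fix A
  have "measure \<mu> A \<le> 1" "0 \<le> \<gamma> * measure \<nu> A"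
    using assms by (auto intro: prob_space.prob_le_1)
  then show "measure \<mu> A - \<gamma> * measure \<nu> A \<le> 1" by linarith
qed

lemma hockey_stick_nonneg:
  assumes "prob_space \<mu>" "prob_space \<nu>" "sets \<nu> = sets \<mu>" "0 \<le> \<gamma>"
  shows "0 \<le> hockey_stick \<gamma> \<mu> \<nu>"
proof -
  have le: "measure \<mu> A - \<gamma> * measure \<nu> A \<le> (SUP A\<in>sets \<mu>. measure \<mu> A - \<gamma> * measure \<nu> A)"
    if "A \<in> sets \<mu>" for A
    using that hockey_stick_bdd[OF assms(1,4)] by (rule cSUP_upper)
  have "measure \<nu> (space \<mu>) = 1"
    using prob_space.prob_space[OF assms(2)] sets_eq_imp_space_eq[OF assms(3)] by simp
  then show ?thesis
    using le[of "{}"] le[of "space \<mu>"] prob_space.prob_space[OF assms(1)]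
    by (simp add: hockey_stick_def)
qed

text \<open>The supremum is taken in \<^typ>\<open>ennreal\<close>, where the supremum of the empty set is \<open>0\<close> and no
  boundedness has to be presupposed. The push-forward of \<open>\<mu>\<close> under \<open>K\<close> is the monadic bind
  \<open>\<mu> \<bind> K\<close>.\<close>

definition contraction_coeff :: "real \<Rightarrow> 'a measure \<Rightarrow> ('a \<Rightarrow> 'b measure) \<Rightarrow> ennreal" where
  "contraction_coeff \<gamma> M K =
     Sup {ennreal (hockey_stick \<gamma> (\<mu> \<bind> K) (\<nu> \<bind> K) / hockey_stick \<gamma> \<mu> \<nu>) | \<mu> \<nu>.
            \<mu> \<in> space (prob_algebra M) \<and> \<nu> \<in> space (prob_algebra M) \<and>
            hockey_stick \<gamma> \<mu> \<nu> \<noteq> 0}"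

end

theory Submission
  imports Defs
begin

text \<open>
  A Hahn set of \<open>\<mu> - \<gamma> \<nu>\<close> shows that \<open>\<integral>g d\<mu> - \<gamma> \<integral>g d\<nu> \<le> E\<^sub>\<gamma>(\<mu>\<parallel>\<nu>)\<close> for \<open>\<gamma> \<ge> 1\<close> and every
  measurable \<open>0 \<le> g \<le> 1\<close>. Apply this to the rescaling \<open>(f - m) / (S - m)\<close> of \<open>f x = K(A|x)\<close>, where
  \<open>S\<close> and \<open>m\<close> are the supremum and infimum of \<open>f\<close>: since \<open>E\<^sub>\<gamma> \<le> 1\<close>,
  \<open>\<mu>K(A) - \<gamma> \<nu>K(A) \<le> (S - m) E\<^sub>\<gamma> + m (1 - \<gamma>) \<le> (S - \<gamma> m) E\<^sub>\<gamma>\<close>, and \<open>S - \<gamma> m\<close> is at most the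
  supremum over pairs of points. Dirac measures give the reverse inequality. For \<open>\<gamma> < 1\<close>, taking
  complements gives \<open>E\<^sub>\<gamma>(\<mu>\<parallel>\<nu>) = \<gamma> E\<^bsub>1/\<gamma>\<^esub>(\<nu>\<parallel>\<mu>)\<close>, and the factor \<open>\<gamma>\<close> cancels in the ratio.
\<close>

section \<open>Hahn sets and integrals of functions with values in [0,1]\<close>

text \<open>Domination on every measurable subset of \<open>Y\<close> is domination of the
  restricted measures, and the nonnegative integral is monotone in the measure. The bound
  \<open>B\<close> gives integrability, so that Bochner integrals can be exchanged with nonnegative
  ones.\<close>

lemma set_integral_mono_measure_subsets:
  fixes h :: "'a \<Rightarrow> real"
  assumes "finite_measure M" "finite_measure N" and sets: "sets N = sets M"
    and Y: "Y \<in> sets M"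
    and le: "\<And>X. X \<in> sets M \<Longrightarrow> X \<subseteq> Y \<Longrightarrow> emeasure N X \<le> emeasure M X"
    and h: "h \<in> borel_measurable M" "\<And>x. 0 \<le> h x" "\<And>x. h x \<le> B"
  shows "(\<integral>x. indicator Y x * h x \<partial>N) \<le> (\<integral>x. indicator Y x * h x \<partial>M)"
proof -
  interpret M: finite_measure M by fact
  interpret N: finite_measure N by fact
  have [measurable]: "h \<in> borel_measurable M" "h \<in> borel_measurable N"
    "Y \<in> sets M" "Y \<in> sets N"
    using h Y sets by (simp_all cong: measurable_cong_sets)
  have bound: "norm (indicator Y x * h x) \<le> B" for x
    using h(2,3)[of x] by (auto simp: indicator_def)
  have intM: "integrable M (\<lambda>x. indicator Y x * h x)"
    by (rule M.integrable_const_bound[where B=B]) (use bound in auto)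
  have intN: "integrable N (\<lambda>x. indicator Y x * h x)"
    by (rule N.integrable_const_bound[where B=B]) (use bound in auto)
  \<comment> \<open>Each restricted measure evaluates a set through its intersection with
    \<open>Y\<close>, where \<open>le\<close> applies.\<close>
  have dens: "density N (indicator Y) \<le> density M (indicator Y)"
    using sets le Y
    by (subst le_measure) (auto simp: emeasure_restricted le_fun_def sets.Int)
  have eq: "ennreal (indicator Y x * h x) = indicator Y x * ennreal (h x)" for x
    by (simp add: indicator_def)
  have "ennreal (\<integral>x. indicator Y x * h x \<partial>N) = (\<integral>\<^sup>+x. indicator Y x * ennreal (h x) \<partial>N)"
    using nn_integral_eq_integral[OF intN] h(2) by (simp add: eq)
  also have "\<dots> = (\<integral>\<^sup>+x. ennreal (h x) \<partial>density N (indicator Y))"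
    by (simp add: nn_integral_density)
  also have "\<dots> \<le> (\<integral>\<^sup>+x. ennreal (h x) \<partial>density M (indicator Y))"
    by (rule nn_integral_mono_measure) (use sets dens in auto)
  also have "\<dots> = (\<integral>\<^sup>+x. indicator Y x * ennreal (h x) \<partial>M)"
    by (simp add: nn_integral_density)
  also have "\<dots> = ennreal (\<integral>x. indicator Y x * h x \<partial>M)"
    using nn_integral_eq_integral[OF intM] h(2) by (simp add: eq)
  finally show ?thesis
    using h(2) by (subst (asm) ennreal_le_iff) (auto intro!: integral_nonneg_AE)
qed

text \<open>For a Hahn set \<open>Y\<close> of \<open>M\<close> minus \<open>N\<close>, replacing
  \<open>g\<close> by the indicator of \<open>Y\<close> raises \<open>g\<close> to 1 where
  \<open>M\<close> dominates and lowers it to 0 where \<open>N\<close> dominates. Both changes can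
  only increase the difference of the integrals.\<close>

lemma ex_set_integral_diff_le:
  fixes g :: "'a \<Rightarrow> real"
  assumes "finite_measure M" "finite_measure N" and sets: "sets N = sets M"
    and g: "g \<in> borel_measurable M" "\<And>x. 0 \<le> g x" "\<And>x. g x \<le> 1"
  shows "\<exists>Y\<in>sets M. (\<integral>x. g x \<partial>M) - (\<integral>x. g x \<partial>N) \<le> measure M Y - measure N Y"
proof -
  interpret M: finite_measure M by fact
  interpret N: finite_measure N by fact
  obtain Y where Y: "Y \<in> sets M"
    and Y1: "\<And>X. X \<in> sets M \<Longrightarrow> X \<subseteq> Y \<Longrightarrow> emeasure N X \<le> emeasure M X"
    and Y2: "\<And>X. X \<in> sets M \<Longrightarrow> X \<inter> Y = {} \<Longrightarrow> emeasure M X \<le> emeasure N X"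
    using finite_unsigned_Hahn_decomposition[OF assms(1-3)] by blast
  let ?Z = "space M - Y"
  have [measurable]: "g \<in> borel_measurable M" "g \<in> borel_measurable N"
    "Y \<in> sets M" "Y \<in> sets N" "?Z \<in> sets M" "?Z \<in> sets N"
    using g Y sets by (auto cong: measurable_cong_sets)
  have on_Y: "(\<integral>x. indicator Y x * (1 - g x) \<partial>N) \<le> (\<integral>x. indicator Y x * (1 - g x) \<partial>M)"
    by (rule set_integral_mono_measure_subsets[where B=1]) (use assms Y Y1 in auto)
  have Y2': "emeasure M X \<le> emeasure N X" if "X \<in> sets M" "X \<subseteq> ?Z" for X
    using that by (intro Y2) auto
  have on_Z: "(\<integral>x. indicator ?Z x * g x \<partial>M) \<le> (\<integral>x. indicator ?Z x * g x \<partial>N)"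
    by (rule set_integral_mono_measure_subsets[where B=1])
      (use assms Y Y2' in \<open>auto cong: measurable_cong_sets\<close>)
  \<comment> \<open>On the space, \<open>g\<close> is the indicator of \<open>Y\<close> minus what
    it lacks on \<open>Y\<close> plus its part on \<open>?Z\<close>. Used for both measures;
    \<open>on_Y\<close> and \<open>on_Z\<close> give the signs of the two corrections.\<close>
  have split: "(\<integral>x. g x \<partial>L) = measure L Y - (\<integral>x. indicator Y x * (1 - g x) \<partial>L)
      + (\<integral>x. indicator ?Z x * g x \<partial>L)"
    if "finite_measure L" and L: "sets L = sets M" for L
  proof -
    interpret finite_measure L by fact
    have sp: "space L = space M" using L by (rule sets_eq_imp_space_eq)
    have [measurable]: "g \<in> borel_measurable L" "Y \<in> sets L" "?Z \<in> sets L"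
      using g Y L by (auto cong: measurable_cong_sets)
    have ints: "integrable L (\<lambda>x. indicator Y x * (1 - g x))"
      "integrable L (\<lambda>x. indicator ?Z x * g x)"
      by (rule integrable_const_bound[where B=1], use g(2,3) in \<open>auto split: split_indicator\<close>)+
    have "integrable L (indicator Y :: 'a \<Rightarrow> real)"
      by (rule integrable_const_bound[where B=1]) (auto split: split_indicator)
    note ints = ints this
    have "(\<integral>x. g x \<partial>L)
        = (\<integral>x. (indicator Y x - indicator Y x * (1 - g x)) + indicator ?Z x * g x \<partial>L)"
      by (rule Bochner_Integration.integral_cong) (auto simp: indicator_def sp)
    also have "\<dots> = measure L Y - (\<integral>x. indicator Y x * (1 - g x) \<partial>L)
        + (\<integral>x. indicator ?Z x * g x \<partial>L)"
      using ints sets.sets_into_space[OF Y] by (simp add: sp Int_absorb2)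
    finally show ?thesis .
  qed
  show ?thesis
    using split[OF assms(1) refl] split[OF assms(2) sets] on_Y on_Z Y
    by (intro bexI[of _ Y]) linarith+
qed

section \<open>The divergence for \<gamma> \<ge> 1 and its functional form\<close>

text \<open>For \<gamma> \<ge> 1 the subtracted term \<open>max 0 (1 - \<gamma>)\<close> vanishes,
  so the divergence is the plain supremum over events.\<close>

lemma hockey_stick_upper:
  assumes "prob_space \<mu>" "1 \<le> \<gamma>" "A \<in> sets \<mu>"
  shows "measure \<mu> A - \<gamma> * measure \<nu> A \<le> hockey_stick \<gamma> \<mu> \<nu>"
  using cSUP_upper[OF assms(3) hockey_stick_bdd[OF assms(1), of \<gamma> \<nu>]] assms(2)
  by (simp add: hockey_stick_def)

lemma hockey_stick_least:
  assumes "1 \<le> \<gamma>" "\<And>A. A \<in> sets \<mu> \<Longrightarrow> measure \<mu> A - \<gamma> * measure \<nu> A \<le> c"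
  shows "hockey_stick \<gamma> \<mu> \<nu> \<le> c"
proof -
  have "sets \<mu> \<noteq> {}" by auto
  then show ?thesis
    using cSUP_least[of "sets \<mu>" "\<lambda>A. measure \<mu> A - \<gamma> * measure \<nu> A" c] assms
    by (simp add: hockey_stick_def)
qed

lemma hockey_stick_le_1:
  assumes "prob_space \<mu>" "1 \<le> \<gamma>"
  shows "hockey_stick \<gamma> \<mu> \<nu> \<le> 1"
proof (rule hockey_stick_least[OF assms(2)])
  fix A
  have "measure \<mu> A \<le> 1" "0 \<le> \<gamma> * measure \<nu> A"
    using assms by (auto intro: prob_space.prob_le_1)
  then show "measure \<mu> A - \<gamma> * measure \<nu> A \<le> 1" by linarith
qed

lemma integral_diff_le_hockey_stick:
  fixes g :: "'a \<Rightarrow> real"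
  assumes \<mu>: "prob_space \<mu>" and \<nu>: "prob_space \<nu>" and sets: "sets \<nu> = sets \<mu>" and \<gamma>: "1 \<le> \<gamma>"
    and g: "g \<in> borel_measurable \<mu>" "\<And>x. 0 \<le> g x" "\<And>x. g x \<le> 1"
  shows "(\<integral>x. g x \<partial>\<mu>) - \<gamma> * (\<integral>x. g x \<partial>\<nu>) \<le> hockey_stick \<gamma> \<mu> \<nu>"
proof -
  interpret \<mu>: prob_space \<mu> by fact
  interpret \<nu>: prob_space \<nu> by fact
  \<comment> \<open>The multiple \<gamma>\<nu> as a finite measure, so that the comparison applies
    to \<mu> and \<gamma>\<nu>.\<close>
  let ?N = "density \<nu> (\<lambda>_. ennreal \<gamma>)"
  have [measurable]: "g \<in> borel_measurable \<nu>"
    using g sets by (simp cong: measurable_cong_sets)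
  have "finite_measure ?N"
    by (rule finite_measureI)
      (use \<gamma> in \<open>simp add: emeasure_density_const \<nu>.emeasure_space_1\<close>)
  then obtain Y where Y: "Y \<in> sets \<mu>"
    and le: "(\<integral>x. g x \<partial>\<mu>) - (\<integral>x. g x \<partial>?N) \<le> measure \<mu> Y - measure ?N Y"
    using ex_set_integral_diff_le[of \<mu> ?N g] g sets \<mu>.finite_measure_axioms by auto
  have "(\<integral>x. g x \<partial>?N) = \<gamma> * (\<integral>x. g x \<partial>\<nu>)"
    using \<gamma> by (subst integral_density) auto
  moreover have "measure ?N Y = \<gamma> * measure \<nu> Y"
    using \<gamma> Y sets by (simp add: measure_def emeasure_density_const enn2real_mult)
  ultimately show ?thesis
    using le hockey_stick_upper[OF \<mu> \<gamma> Y, of \<nu>] by simp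
qed

text \<open>Affine rescaling of \<open>f\<close> to [0,1]. The shift by \<open>a\<close> contributes
  \<open>a * (1 - \<gamma>)\<close> because both measures have total mass 1.\<close>

lemma integral_diff_le_hockey_stick_range:
  fixes f :: "'a \<Rightarrow> real"
  assumes \<mu>: "prob_space \<mu>" and \<nu>: "prob_space \<nu>" and sets: "sets \<nu> = sets \<mu>" and \<gamma>: "1 \<le> \<gamma>"
    and f: "f \<in> borel_measurable \<mu>" "\<And>x. x \<in> space \<mu> \<Longrightarrow> a \<le> f x" "\<And>x. x \<in> space \<mu> \<Longrightarrow> f x \<le> b"
  shows "(\<integral>x. f x \<partial>\<mu>) - \<gamma> * (\<integral>x. f x \<partial>\<nu>) \<le> (b - a) * hockey_stick \<gamma> \<mu> \<nu> + a * (1 - \<gamma>)"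
proof -
  interpret \<mu>: prob_space \<mu> by fact
  interpret \<nu>: prob_space \<nu> by fact
  have sp: "space \<nu> = space \<mu>" using sets by (rule sets_eq_imp_space_eq)
  have ab: "a \<le> b" using \<mu>.not_empty f(2,3) order_trans by blast
  \<comment> \<open>The value 0 off the space makes the bounds on \<open>g\<close> hold at every
    point. If \<open>a = b\<close>, division by zero gives 0, which fits since \<open>f\<close> is
    then constantly \<open>a\<close>.\<close>
  define g where "g x = (if x \<in> space \<mu> then (f x - a) / (b - a) else 0)" for x
  have g: "0 \<le> g x" "g x \<le> 1" for x
    using f(2,3)[of x] ab by (auto simp: g_def divide_le_eq_1)
  have "g \<in> borel_measurable \<mu> \<longleftrightarrow> (\<lambda>x. (f x - a) / (b - a)) \<in> borel_measurable \<mu>"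
    by (rule measurable_cong) (simp add: g_def)
  then have gm: "g \<in> borel_measurable \<mu>" using f(1) by simp
  have gm': "g \<in> borel_measurable \<nu>" using gm sets by (simp cong: measurable_cong_sets)
  have fg: "f x = (b - a) * g x + a" if "x \<in> space \<mu>" for x
    using f(2,3)[OF that] that by (cases "a = b") (auto simp: g_def)
  have "integrable \<mu> g" "integrable \<nu> g"
    by (rule \<mu>.integrable_const_bound[where B=1] \<nu>.integrable_const_bound[where B=1],
        use g gm gm' in auto)+
  then have ig: "(\<integral>x. (b - a) * g x + a \<partial>\<mu>) = (b - a) * (\<integral>x. g x \<partial>\<mu>) + a"
    "(\<integral>x. (b - a) * g x + a \<partial>\<nu>) = (b - a) * (\<integral>x. g x \<partial>\<nu>) + a"
    using \<mu>.prob_space \<nu>.prob_space by simp_all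
  have fi: "(\<integral>x. f x \<partial>\<mu>) = (b - a) * (\<integral>x. g x \<partial>\<mu>) + a"
    "(\<integral>x. f x \<partial>\<nu>) = (b - a) * (\<integral>x. g x \<partial>\<nu>) + a"
    unfolding ig[symmetric] by (rule Bochner_Integration.integral_cong; simp add: fg sp)+
  have "(\<integral>x. f x \<partial>\<mu>) - \<gamma> * (\<integral>x. f x \<partial>\<nu>)
      = (b - a) * ((\<integral>x. g x \<partial>\<mu>) - \<gamma> * (\<integral>x. g x \<partial>\<nu>)) + a * (1 - \<gamma>)"
    unfolding fi by (simp add: algebra_simps)
  also have "\<dots> \<le> (b - a) * hockey_stick \<gamma> \<mu> \<nu> + a * (1 - \<gamma>)"
    using integral_diff_le_hockey_stick[OF \<mu> \<nu> sets \<gamma> gm g] ab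
    by (intro add_right_mono mult_left_mono) auto
  finally show ?thesis .
qed

section \<open>Contraction under a Markov kernel\<close>

text \<open>The strong data-processing inequality, which yields the upper bound on the coefficient.
  Any uniform bound \<open>s\<close> over pairs of points may serve as the constant.\<close>

lemma hockey_stick_bind_le:
  assumes \<mu>: "\<mu> \<in> space (prob_algebra M)" and \<nu>: "\<nu> \<in> space (prob_algebra M)"
    and K: "K \<in> M \<rightarrow>\<^sub>M prob_algebra N" and \<gamma>: "1 \<le> \<gamma>"
    and s: "\<And>x y. x \<in> space M \<Longrightarrow> y \<in> space M \<Longrightarrow> hockey_stick \<gamma> (K x) (K y) \<le> s"
  shows "hockey_stick \<gamma> (\<mu> \<bind> K) (\<nu> \<bind> K) \<le> s * hockey_stick \<gamma> \<mu> \<nu>"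
proof (rule hockey_stick_least[OF \<gamma>])
  fix A assume "A \<in> sets (\<mu> \<bind> K)"
  then have A: "A \<in> sets N" using sets_bind'[OF \<mu> K] by simp
  have p: "prob_space \<mu>" "prob_space \<nu>" and sets: "sets \<mu> = sets M" "sets \<nu> = sets M"
    using \<mu> \<nu> by (auto simp: space_prob_algebra)
  interpret \<mu>: prob_space \<mu> by fact
  interpret \<nu>: prob_space \<nu> by fact
  have sp: "space \<mu> = space M" "space \<nu> = space M"
    using sets by (auto dest: sets_eq_imp_space_eq)
  then have ne: "space M \<noteq> {}" using \<mu>.not_empty by simp
  have Kp: "prob_space (K x)" "sets (K x) = sets N" if "x \<in> space M" for x
    using measurable_space[OF K that] by (auto simp: space_prob_algebra)
  define f where "f x = measure (K x) A" for x
  have f01: "0 \<le> f x" "x \<in> space M \<Longrightarrow> f x \<le> 1" for x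
    using prob_space.prob_le_1[OF Kp(1)] by (auto simp: f_def)
  have fm: "f \<in> borel_measurable \<mu>"
    using measurable_compose[OF K measurable_measure_prob_algebra[OF A]] sets
    by (simp add: f_def[abs_def] cong: measurable_cong_sets)
  \<comment> \<open>The event \<open>A\<close> is one of the competitors in the divergence of
    \<open>K x\<close> from \<open>K y\<close>.\<close>
  have fs: "f x - \<gamma> * f y \<le> s" if "x \<in> space M" "y \<in> space M" for x y
    using hockey_stick_upper[OF Kp(1) \<gamma>, of x A "K y"] s[OF that] Kp(2) A that
    by (simp add: f_def)
  define a where "a = (INF x\<in>space M. f x)"
  define b where "b = (SUP x\<in>space M. f x)"
  have bdd: "bdd_below (f ` space M)" "bdd_above (f ` space M)"
    using f01 by (auto intro: bdd_belowI2[where m=0] bdd_aboveI2[where M=1])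
  have af: "a \<le> f x" and fb: "f x \<le> b" if "x \<in> space M" for x
    unfolding a_def b_def using bdd that by (auto intro: cINF_lower cSUP_upper)
  have a0: "0 \<le> a" unfolding a_def using ne f01 by (auto intro: cINF_greatest)
  \<comment> \<open>The extrema of \<open>f\<close> need not be attained, so \<open>fs\<close> is
    passed to the limit in two stages: the infimum over \<open>y\<close> with \<open>x\<close>
    fixed, then the supremum over \<open>x\<close>.\<close>
  have "(f x - s) / \<gamma> \<le> a" if "x \<in> space M" for x
    unfolding a_def using ne fs[OF that] \<gamma>
    by (intro cINF_greatest) (auto simp: pos_divide_le_eq algebra_simps)
  then have "b \<le> s + \<gamma> * a"
    unfolding b_def using ne \<gamma> by (intro cSUP_least) (auto simp: pos_divide_le_eq algebra_simps)
  then have bs: "b - \<gamma> * a \<le> s" by simp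
  let ?E = "hockey_stick \<gamma> \<mu> \<nu>"
  have E: "0 \<le> ?E" "?E \<le> 1"
    using hockey_stick_nonneg[OF p] hockey_stick_le_1[OF p(1) \<gamma>] sets \<gamma> by auto
  have K\<mu>: "K \<in> \<mu> \<rightarrow>\<^sub>M subprob_algebra N" "K \<in> \<nu> \<rightarrow>\<^sub>M subprob_algebra N"
    using measurable_prob_algebraD[OF K] sets by (simp_all cong: measurable_cong_sets)
  have "measure (\<mu> \<bind> K) A - \<gamma> * measure (\<nu> \<bind> K) A = (\<integral>x. f x \<partial>\<mu>) - \<gamma> * (\<integral>x. f x \<partial>\<nu>)"
    unfolding f_def using \<mu>.measure_bind[OF K\<mu>(1) A] \<nu>.measure_bind[OF K\<mu>(2) A] by simp
  also have "\<dots> \<le> (b - a) * ?E + a * (1 - \<gamma>)"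
    by (rule integral_diff_le_hockey_stick_range) (use p sets \<gamma> fm af fb sp in auto)
  \<comment> \<open>The constant term is at most 0, so multiplying it by \<open>?E\<close>, which
    lies in [0,1], can only increase it. The whole bound becomes proportional to
    \<open>?E\<close>.\<close>
  also have "\<dots> \<le> (b - a) * ?E + a * (1 - \<gamma>) * ?E"
  proof -
    have "(a * (\<gamma> - 1)) * ?E \<le> (a * (\<gamma> - 1)) * 1"
      using a0 \<gamma> E by (intro mult_left_mono) auto
    then show ?thesis by (simp add: algebra_simps)
  qed
  also have "\<dots> = (b - \<gamma> * a) * ?E" by (simp add: algebra_simps)
  also have "\<dots> \<le> s * ?E" using bs E by (intro mult_right_mono)
  finally show "measure (\<mu> \<bind> K) A - \<gamma> * measure (\<nu> \<bind> K) A \<le> s * ?E" .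
qed

text \<open>The event {x} separates the two point masses and attains the general upper bound 1.
  Dirac pairs therefore have denominator 1 in the contraction ratio.\<close>

lemma hockey_stick_return:
  assumes "x \<in> space M" "y \<in> space M" "x \<noteq> y" "{x} \<in> sets M" "1 \<le> \<gamma>"
  shows "hockey_stick \<gamma> (return M x) (return M y) = 1"
proof -
  have p: "prob_space (return M x)" using assms by (simp add: prob_space_return)
  have "measure (return M x) {x} - \<gamma> * measure (return M y) {x} = 1"
    using assms by (simp add: measure_return)
  then show ?thesis
    using hockey_stick_upper[OF p assms(5), of "{x}" "return M y"]
      hockey_stick_le_1[OF p assms(5), of "return M y"] assms by simp
qed

lemma hockey_stick_self_eq_0:
  assumes "prob_space \<mu>" "1 \<le> \<gamma>"
  shows "hockey_stick \<gamma> \<mu> \<mu> = 0"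
proof (rule antisym)
  show "hockey_stick \<gamma> \<mu> \<mu> \<le> 0"
    using assms(2) by (intro hockey_stick_least) (auto simp: mult_le_cancel_right1)
qed (use assms in \<open>auto intro: hockey_stick_nonneg\<close>)

lemma contraction_coeff_eq_SUP:
  assumes K: "K \<in> M \<rightarrow>\<^sub>M prob_algebra N" and \<gamma>: "1 \<le> \<gamma>"
    and single: "\<And>x. x \<in> space M \<Longrightarrow> {x} \<in> sets M"
  shows "contraction_coeff \<gamma> M K
    = (SUP (x, y)\<in>space M \<times> space M. ennreal (hockey_stick \<gamma> (K x) (K y)))" (is "_ = ?S")
proof (rule antisym)
  have Kp: "prob_space (K x)" "sets (K x) = sets N" if "x \<in> space M" for x
    using measurable_space[OF K that] by (auto simp: space_prob_algebra)
  show "contraction_coeff \<gamma> M K \<le> ?S"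
    unfolding contraction_coeff_def
  proof (rule Sup_least, clarify)
    fix \<mu> \<nu> assume \<mu>: "\<mu> \<in> space (prob_algebra M)" and \<nu>: "\<nu> \<in> space (prob_algebra M)"
      and ne: "hockey_stick \<gamma> \<mu> \<nu> \<noteq> 0"
    have pos: "0 < hockey_stick \<gamma> \<mu> \<nu>"
      using hockey_stick_nonneg[of \<mu> \<nu> \<gamma>] \<mu> \<nu> ne \<gamma> by (auto simp: space_prob_algebra)
    show "ennreal (hockey_stick \<gamma> (\<mu> \<bind> K) (\<nu> \<bind> K) / hockey_stick \<gamma> \<mu> \<nu>) \<le> ?S"
    \<comment> \<open>A finite supremum supplies the real constant for
      \<open>hockey_stick_bind_le\<close>; an infinite one bounds everything.\<close>
    proof (cases ?S)
      case (real s)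
      have "hockey_stick \<gamma> (K x) (K y) \<le> s" if "x \<in> space M" "y \<in> space M" for x y
      proof -
        have "ennreal (hockey_stick \<gamma> (K x) (K y)) \<le> ?S"
          using that by (intro SUP_upper2[of "(x, y)"]) auto
        then show ?thesis using real by simp
      qed
      then have "hockey_stick \<gamma> (\<mu> \<bind> K) (\<nu> \<bind> K) \<le> s * hockey_stick \<gamma> \<mu> \<nu>"
        by (rule hockey_stick_bind_le[OF \<mu> \<nu> K \<gamma>])
      then show ?thesis using pos real by (simp add: pos_divide_le_eq ennreal_leI)
    next
      case top
      then show ?thesis by (simp only: top_greatest)
    qed
  qed
  show "?S \<le> contraction_coeff \<gamma> M K"
  proof (rule SUP_least, clarify)
    fix x y assume x: "x \<in> space M" and y: "y \<in> space M"
    show "ennreal (hockey_stick \<gamma> (K x) (K y)) \<le> contraction_coeff \<gamma> M K"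
    \<comment> \<open>Equal points give Dirac measures of divergence 0, which the coefficient
      excludes; their contribution to \<open>?S\<close> is 0 anyway.\<close>
    proof (cases "x = y")
      case True
      then show ?thesis using hockey_stick_self_eq_0[OF Kp(1)[OF x] \<gamma>] by simp
    next
      case False
      have one: "hockey_stick \<gamma> (return M x) (return M y) = 1"
        by (rule hockey_stick_return[OF x y False single[OF x] \<gamma>])
      have "return M x \<bind> K = K x" "return M y \<bind> K = K y"
        using bind_return[OF measurable_prob_algebraD[OF K]] x y by auto
      then show ?thesis
        unfolding contraction_coeff_def using x y one
        by (intro Sup_upper CollectI exI[of _ "return M x"] exI[of _ "return M y"])
          (auto simp: space_prob_algebra prob_space_return)
    qed
  qed
qed

section \<open>Reciprocity between \<gamma> and 1/\<gamma>\<close>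

text \<open>Complementation permutes the events and turns one objective into \<gamma> times the
  other plus \<open>1 - \<gamma>\<close>. That constant is exactly the one subtracted for \<gamma> <
  1, while nothing is subtracted for \<open>1 / \<gamma>\<close>.\<close>

lemma hockey_stick_reciprocal:
  assumes \<mu>: "prob_space \<mu>" and \<nu>: "prob_space \<nu>" and sets: "sets \<nu> = sets \<mu>"
    and \<gamma>: "0 < \<gamma>" "\<gamma> < 1"
  shows "hockey_stick \<gamma> \<mu> \<nu> = \<gamma> * hockey_stick (1 / \<gamma>) \<nu> \<mu>"
proof -
  interpret \<mu>: prob_space \<mu> by fact
  interpret \<nu>: prob_space \<nu> by fact
  have sp: "space \<nu> = space \<mu>" using sets by (rule sets_eq_imp_space_eq)
  have \<gamma>': "1 \<le> 1 / \<gamma>" using \<gamma> by simp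
  have ne: "sets \<mu> \<noteq> {}" by auto
  have compl: "measure \<mu> (space \<mu> - A) - \<gamma> * measure \<nu> (space \<mu> - A)
      = \<gamma> * (measure \<nu> A - 1 / \<gamma> * measure \<mu> A) + (1 - \<gamma>)" if A: "A \<in> sets \<mu>" for A
  proof -
    have "A \<in> sets \<nu>" using A sets by simp
    then show ?thesis
      unfolding \<mu>.prob_compl[OF A] \<nu>.prob_compl[of A, unfolded sp] using \<gamma>
      by (simp add: \<nu>.prob_compl[of A, unfolded sp] algebra_simps)
  qed
  let ?S = "SUP A\<in>sets \<mu>. measure \<mu> A - \<gamma> * measure \<nu> A"
  have "?S \<le> \<gamma> * hockey_stick (1 / \<gamma>) \<nu> \<mu> + (1 - \<gamma>)"
  proof (rule cSUP_least[OF ne])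
    fix A assume A: "A \<in> sets \<mu>"
    \<comment> \<open>\<open>compl\<close> is used at the complement of \<open>A\<close>, whose own
      complement is \<open>A\<close> again.\<close>
    then have "measure \<mu> A - \<gamma> * measure \<nu> A
        = \<gamma> * (measure \<nu> (space \<mu> - A) - 1 / \<gamma> * measure \<mu> (space \<mu> - A)) + (1 - \<gamma>)"
      using compl[of "space \<mu> - A"] sets.sets_into_space[OF A]
      by (simp add: double_diff)
    also have "\<dots> \<le> \<gamma> * hockey_stick (1 / \<gamma>) \<nu> \<mu> + (1 - \<gamma>)"
      using hockey_stick_upper[OF \<nu> \<gamma>', of "space \<mu> - A" \<mu>] A sets \<gamma>
      by (intro add_right_mono mult_left_mono) auto
    finally show "measure \<mu> A - \<gamma> * measure \<nu> A \<le> \<gamma> * hockey_stick (1 / \<gamma>) \<nu> \<mu> + (1 - \<gamma>)" .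
  qed
  moreover have "hockey_stick (1 / \<gamma>) \<nu> \<mu> \<le> (?S - (1 - \<gamma>)) / \<gamma>"
  proof (rule hockey_stick_least[OF \<gamma>'])
    fix A assume "A \<in> sets \<nu>"
    then have A: "A \<in> sets \<mu>" using sets by simp
    then have "\<gamma> * (measure \<nu> A - 1 / \<gamma> * measure \<mu> A) + (1 - \<gamma>) \<le> ?S"
      unfolding compl[OF A, symmetric]
      using \<gamma> by (intro cSUP_upper hockey_stick_bdd[OF \<mu>]) auto
    then show "measure \<nu> A - 1 / \<gamma> * measure \<mu> A \<le> (?S - (1 - \<gamma>)) / \<gamma>"
      using \<gamma>(1) by (simp only: pos_le_divide_eq le_diff_eq mult.commute[of _ \<gamma>])
  qed
  then have "\<gamma> * hockey_stick (1 / \<gamma>) \<nu> \<mu> \<le> ?S - (1 - \<gamma>)"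
    using \<gamma> by (simp add: pos_le_divide_eq mult.commute)
  ultimately show ?thesis using \<gamma> unfolding hockey_stick_def[of \<gamma>] by simp
qed

text \<open>Numerator and denominator acquire the same factor \<gamma>, which cancels. The exchange
  of \<mu> and \<nu> is harmless because the coefficient ranges over all ordered pairs.\<close>

lemma contraction_coeff_reciprocal:
  assumes K: "K \<in> M \<rightarrow>\<^sub>M prob_algebra N" and \<gamma>: "0 < \<gamma>" "\<gamma> < 1"
  shows "contraction_coeff \<gamma> M K = contraction_coeff (1 / \<gamma>) M K"
proof -
  have rec: "hockey_stick \<gamma> \<mu> \<nu> = \<gamma> * hockey_stick (1 / \<gamma>) \<nu> \<mu>"
    "hockey_stick \<gamma> (\<mu> \<bind> K) (\<nu> \<bind> K) = \<gamma> * hockey_stick (1 / \<gamma>) (\<nu> \<bind> K) (\<mu> \<bind> K)"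
    if "\<mu> \<in> space (prob_algebra M)" "\<nu> \<in> space (prob_algebra M)" for \<mu> \<nu>
    using that \<gamma> prob_space_bind'[OF _ K] sets_bind'[OF _ K]
    by (auto simp: space_prob_algebra intro!: hockey_stick_reciprocal)
  let ?R = "\<lambda>\<gamma> \<mu> \<nu>. ennreal (hockey_stick \<gamma> (\<mu> \<bind> K) (\<nu> \<bind> K) / hockey_stick \<gamma> \<mu> \<nu>)"
  have swap: "?R \<gamma> \<mu> \<nu> = ?R (1 / \<gamma>) \<nu> \<mu>"
    "hockey_stick \<gamma> \<mu> \<nu> \<noteq> 0 \<longleftrightarrow> hockey_stick (1 / \<gamma>) \<nu> \<mu> \<noteq> 0"
    if "\<mu> \<in> space (prob_algebra M)" "\<nu> \<in> space (prob_algebra M)" for \<mu> \<nu>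
    using rec[OF that] \<gamma> by auto
  have "{?R \<gamma> \<mu> \<nu> | \<mu> \<nu>. \<mu> \<in> space (prob_algebra M) \<and> \<nu> \<in> space (prob_algebra M)
        \<and> hockey_stick \<gamma> \<mu> \<nu> \<noteq> 0}
      = {?R (1 / \<gamma>) \<mu> \<nu> | \<mu> \<nu>. \<mu> \<in> space (prob_algebra M) \<and> \<nu> \<in> space (prob_algebra M)
        \<and> hockey_stick (1 / \<gamma>) \<mu> \<nu> \<noteq> 0}"
    using swap by (intro set_eqI iffI; clarify; metis)
  then show ?thesis by (simp add: contraction_coeff_def)
qed

theorem theorem2:
  fixes D :: "'a::euclidean_space set" and W :: "'b::euclidean_space set"
    and K :: "'a \<Rightarrow> 'b measure"
  assumes "D \<noteq> {}" and "W \<noteq> {}"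
    and "K \<in> restrict_space borel D \<rightarrow>\<^sub>M prob_algebra (restrict_space borel W)"
  shows "(\<forall>\<gamma>\<ge>1. contraction_coeff \<gamma> (restrict_space borel D) K =
             (SUP (x\<^sub>1, x\<^sub>2)\<in>D \<times> D. ennreal (hockey_stick \<gamma> (K x\<^sub>1) (K x\<^sub>2)))) \<and>
         (\<forall>\<gamma>. 0 < \<gamma> \<and> \<gamma> < 1 \<longrightarrow>
             contraction_coeff \<gamma> (restrict_space borel D) K =
             contraction_coeff (1 / \<gamma>) (restrict_space borel D) K)"

proof -
  have sp: "space (restrict_space borel D) = D" by (simp add: space_restrict_space)
  \<comment> \<open>A singleton is Borel and is its own trace on \<open>D\<close>; this supplies the
    measurable singletons that separate Dirac measures.\<close>
  have "{x} \<in> sets (restrict_space borel D)" if "x \<in> D" for x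
    using that by (auto simp: sets_restrict_space intro!: image_eqI[of _ _ "{x}"])
  then show ?thesis
    using contraction_coeff_eq_SUP[OF assms(3)] contraction_coeff_reciprocal[OF assms(3)]
    by (simp add: sp)
qed

end
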